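(* Let $\{2,a,b,c\}$ be a regular Diophantine quadruple. Then the Diophantine triple $\{a,b,c\}$ is also a $D(n)$-set for two distinct $n$'s with $n\neq 1$.
   Context: For a nonzero integer $n$, a set of distinct nonzero integers $\{a_1,\ldots,a_m\}$ such that $a_ia_j+n$ is a perfect square for all $1\le i<j\le m$ is called a $D(n)$-set; a $D(1)$-set is called a Diophantine $m$-tuple. For a Diophantine triple $\{a,b,c\}$ with $bc+1=r^2$, $ca+1=s^2$, $ab+1=t^2$ ($r,s,t$ positive integers), the Diophantine quadruple $\{a,b,c,d\}$ with $d=a+b+c+2abc+2rst$ is called regular; more generally, a Diophantine quadruple $\{a,b,c,d\}$ is regular if $(a+b-c-d)^2=4(ab+1)(cd+1)$. In particular, $\{2,a,b,c\}$ is a regular Diophantine quadruple exactly when $\{2,a,b\}$ is a Diophantine triple and $c=2+a+b+4ab\pm 2\sqrt{(2a+1)(2b+1)(ab+1)}$. *)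

theory Defs
  imports "HOL-Computational_Algebra.Nth_Powers"
begin

(* The members may be arbitrary nonzero integers; positivity is not required, and 0 counts
   as a perfect square. *)
definition D_set :: "int \<Rightarrow> int set \<Rightarrow> bool" where
  "D_set n A \<longleftrightarrow> n \<noteq> 0 \<and> finite A \<and> 0 \<notin> A \<and>
     (\<forall>x\<in>A. \<forall>y\<in>A. x \<noteq> y \<longrightarrow> is_square (x * y + n))"

definition diophantine_tuple :: "nat \<Rightarrow> int set \<Rightarrow> bool" where
  "diophantine_tuple m A \<longleftrightarrow> D_set 1 A \<and> card A = m"

(* The equation is symmetric in all four variables, so regularity depends only on the set
   {a, b, c, d}. *)
definition regular_diophantine_quadruple :: "int \<Rightarrow> int \<Rightarrow> int \<Rightarrow> int \<Rightarrow> bool" where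
  "regular_diophantine_quadruple a b c d \<longleftrightarrow>
     diophantine_tuple 4 {a, b, c, d} \<and>
     (a + b - c - d)\<^sup>2 = 4 * (a * b + 1) * (c * d + 1)"

end

theory Submission
  imports Defs
begin

text \<open>
  The two values are \<open>n\<^sub>1 = a + b + c\<close> and \<open>n\<^sub>2 = a + b + c + 2abc\<close>. Writing \<open>2a + 1 = r\<^sup>2\<close>,
  \<open>2b + 1 = s\<^sup>2\<close>, \<open>ab + 1 = t\<^sup>2\<close>, regularity reads \<open>c = 2 + a + b + 4ab \<plusminus> 2rst\<close>, whence
  \<open>ab + n\<^sub>1 = (t \<plusminus> rs)\<^sup>2\<close>; it also reads \<open>4(ab + n\<^sub>2) = (a + b - c)\<^sup>2\<close>.
  Both are symmetric in \<open>a, b, c\<close>. Since \<open>2a + 1\<close> is a square, all members are positive,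
  so neither value is \<open>0\<close> or \<open>1\<close>. The value \<open>n\<^sub>2\<close> is the abscissa of the double of \<open>(0, abc)\<close> on
  the curve \<open>y\<^sup>2 = (x + ab)(x + ac)(x + bc)\<close>.
\<close>

text \<open>Regularity is symmetric in its four arguments: pair \<open>a\<close> with
  \<open>b\<close> and \<open>2\<close> with \<open>c\<close>, then move the terms linear in
  \<open>a + b - c\<close> to the right.\<close>

lemma regular_2_iff:
  fixes a b c :: int
  shows "(2 + a - b - c)\<^sup>2 = 4 * (2 * a + 1) * (b * c + 1) \<longleftrightarrow>
    (a + b - c)\<^sup>2 = 4 * (a * b + (a + b + c + 2 * a * b * c))"
  by (simp add: power2_eq_square algebra_simps)

lemma is_square_mult_add_sum:
  fixes a b c :: int
  assumes "is_square (2 * a + 1)" "is_square (2 * b + 1)" "is_square (a * b + 1)"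
    and reg: "(a + b - c)\<^sup>2 = 4 * (a * b + (a + b + c + 2 * a * b * c))"
  shows "is_square (a * b + (a + b + c))"
proof -
  obtain r s t where r: "2 * a + 1 = r\<^sup>2" and s: "2 * b + 1 = s\<^sup>2" and t: "a * b + 1 = t\<^sup>2"
    using assms by (auto elim!: is_nth_powerE)
  \<comment> \<open>Completing the square in \<open>c\<close>.\<close>
  have "(c - (2 + a + b + 4 * a * b))\<^sup>2 = 4 * ((2 * a + 1) * (2 * b + 1) * (a * b + 1))"
    using reg by (simp add: power2_eq_square algebra_simps)
  also have "\<dots> = (2 * (r * s * t))\<^sup>2"
    by (simp add: r s t power_mult_distrib)
  finally have "c - (2 + a + b + 4 * a * b) = 2 * (r * s * t) \<or>
    c - (2 + a + b + 4 * a * b) = - (2 * (r * s * t))"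
    by (simp only: power2_eq_iff)
  then consider "c = 2 + a + b + 4 * a * b + 2 * (r * s * t)"
    | "c = 2 + a + b + 4 * a * b - 2 * (r * s * t)"
    by linarith
  \<comment> \<open>Both sides equal \<open>a * b + a + b\<close> plus
    \<open>2 + a + b + 4 * a * b\<close>, so the remaining \<open>2 * (r * s * t)\<close> in
    \<open>c\<close> is the cross term.\<close>
  moreover have "a * b + 1 + (2 * a + 1) * (2 * b + 1) = t\<^sup>2 + (r * s)\<^sup>2"
    by (simp add: r s t power_mult_distrib)
  ultimately have "a * b + (a + b + c) = (t + r * s)\<^sup>2 \<or> a * b + (a + b + c) = (t - r * s)\<^sup>2"
    by cases (simp_all add: power2_sum power2_diff algebra_simps)
  then show ?thesis
    by (auto intro: is_nth_powerI)
qed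

lemma is_square_if_4_mult_eq_square:
  fixes x y :: int
  assumes "x\<^sup>2 = 4 * y"
  shows "is_square y"
proof -
  have "even (x\<^sup>2)"
    using assms by simp
  then obtain k where "x = 2 * k"
    by (auto elim: evenE)
  with assms have "y = k\<^sup>2"
    by (simp add: power_mult_distrib)
  then show ?thesis
    by simp
qed

lemma pos_if_is_square:
  fixes x :: int
  assumes "is_square (2 * x + 1)" "x \<noteq> 0"
  shows "x > 0"
proof -
  have "2 * x + 1 \<ge> 0"
    using assms(1) by (auto elim!: is_nth_powerE)
  with assms(2) show ?thesis
    by linarith
qed

theorem theorem1:
  fixes a b c :: int
  assumes "regular_diophantine_quadruple 2 a b c"
  shows "\<exists>n\<^sub>1 n\<^sub>2. n\<^sub>1 \<noteq> n\<^sub>2 \<and> n\<^sub>1 \<noteq> 1 \<and> n\<^sub>2 \<noteq> 1 \<and>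
           D_set n\<^sub>1 {a, b, c} \<and> D_set n\<^sub>2 {a, b, c}"
proof -
  have D: "D_set 1 {2, a, b, c}" and card: "card {2, a, b, c} = 4"
    and "(2 + a - b - c)\<^sup>2 = 4 * (2 * a + 1) * (b * c + 1)"
    using assms by (auto simp: regular_diophantine_quadruple_def diophantine_tuple_def)
  then have ab: "(a + b - c)\<^sup>2 = 4 * (a * b + (a + b + c + 2 * a * b * c))"
    by (simp only: regular_2_iff)
  \<comment> \<open>\<open>(a + b - c)\<^sup>2 - 4 * a * b\<close> is symmetric in \<open>a\<close>,
    \<open>b\<close>, \<open>c\<close>, so one equation yields all three.\<close>
  then have ac: "(a + c - b)\<^sup>2 = 4 * (a * c + (a + c + b + 2 * a * c * b))"
    and bc: "(b + c - a)\<^sup>2 = 4 * (b * c + (b + c + a + 2 * b * c * a))"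
    by (simp_all add: power2_eq_square algebra_simps)
  have distinct: "2 \<noteq> a" "2 \<noteq> b" "2 \<noteq> c" "a \<noteq> b" "a \<noteq> c" "b \<noteq> c"
    using card by (auto simp: card_insert_if split: if_splits)
  then have sq: "is_square (2 * a + 1)" "is_square (2 * b + 1)" "is_square (2 * c + 1)"
    "is_square (a * b + 1)" "is_square (a * c + 1)" "is_square (b * c + 1)"
    and nz: "a \<noteq> 0" "b \<noteq> 0" "c \<noteq> 0"
    using D by (auto simp: D_set_def)
  define n\<^sub>1 n\<^sub>2 where "n\<^sub>1 = a + b + c" and "n\<^sub>2 = a + b + c + 2 * a * b * c"
  have pos: "a > 0" "b > 0" "c > 0"
    using pos_if_is_square sq nz by blast+
  then have n: "1 < n\<^sub>1" "n\<^sub>1 < n\<^sub>2"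
    by (simp_all add: n\<^sub>1_def n\<^sub>2_def)
  have "is_square (a * b + n\<^sub>1)" "is_square (a * c + n\<^sub>1)" "is_square (b * c + n\<^sub>1)"
    using is_square_mult_add_sum[OF sq(1,2,4) ab] is_square_mult_add_sum[OF sq(1,3,5) ac]
      is_square_mult_add_sum[OF sq(2,3,6) bc]
    by (simp_all add: n\<^sub>1_def ac_simps)
  then have "D_set n\<^sub>1 {a, b, c}"
    using nz n by (auto simp: D_set_def mult.commute)
  moreover have "is_square (a * b + n\<^sub>2)" "is_square (a * c + n\<^sub>2)" "is_square (b * c + n\<^sub>2)"
    using ab ac bc by (auto intro!: is_square_if_4_mult_eq_square simp: n\<^sub>2_def ac_simps)
  then have "D_set n\<^sub>2 {a, b, c}"
    using nz n by (auto simp: D_set_def mult.commute)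
  ultimately show ?thesis
    using n by (intro exI[of _ n\<^sub>1] exI[of _ n\<^sub>2]) auto
qed

end
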